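(* If $k$ is an integer such that $k>5$, then $\gamma^{SID}(C_{2k+1}(1,4))=k+2$.
   Context: All graphs are simple and undirected. For a graph $G=(V,E)$ and $u\in V$, $N[u]=\{u\}\cup\{v: uv\in E\}$. A code is a nonempty $C\subseteq V$, and $I(C;u)=N[u]\cap C$. $C$ is self-identifying if $I(C;u)\setminus I(C;v)\neq\emptyset$ for all distinct $u,v\in V$. $\gamma^{SID}(G)$ is the minimum cardinality of a self-identifying code in a finite graph $G$. The circulant graph $C_n(1,4)$ has vertex set $\mathbb{Z}_n$, and the open neighbourhood of $u$ is $\{u\pm1,u\pm4\}$ modulo $n$. *)

theory Defs
  imports Complex_Main
begin

record 'a graph =
  verts :: "'a set"
  edges :: "'a set set"

definition simple_graph :: "'a graph \<Rightarrow> bool" where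
  "simple_graph G \<longleftrightarrow>
     (\<forall>e\<in>edges G. \<exists>u\<in>verts G. \<exists>v\<in>verts G. u \<noteq> v \<and> e = {u, v})"

definition closed_nbhd :: "'a graph \<Rightarrow> 'a \<Rightarrow> 'a set" where
  "closed_nbhd G u = {u} \<union> {v. {u, v} \<in> edges G}"

definition is_code :: "'a graph \<Rightarrow> 'a set \<Rightarrow> bool" where
  "is_code G C \<longleftrightarrow> C \<noteq> {} \<and> C \<subseteq> verts G"

definition I_set :: "'a graph \<Rightarrow> 'a set \<Rightarrow> 'a \<Rightarrow> 'a set" where
  "I_set G C u = closed_nbhd G u \<inter> C"

definition self_identifying_code :: "'a graph \<Rightarrow> 'a set \<Rightarrow> bool" where
  "self_identifying_code G C \<longleftrightarrow>
     is_code G C \<and>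
     (\<forall>u\<in>verts G. \<forall>v\<in>verts G. u \<noteq> v \<longrightarrow> I_set G C u - I_set G C v \<noteq> {})"

text \<open>Only meaningful for a finite graph that admits a self-identifying code;
  otherwise the value of \<open>Min\<close> is unspecified.\<close>

definition gamma_SID :: "'a graph \<Rightarrow> nat" where
  "gamma_SID G = Min {card C | C. self_identifying_code G C}"

text \<open>\<open>\<int>\<^sub>n\<close> is represented by the residues \<open>0, \<dots>, n - 1\<close>.\<close>

definition circulant_1_4 :: "int \<Rightarrow> int graph" where
  "circulant_1_4 n =
     \<lparr>verts = {0..<n},
      edges = {{u, v} | u v. u \<in> {0..<n} \<and>
        v \<in> {(u + 1) mod n, (u - 1) mod n, (u + 4) mod n, (u - 4) mod n}}\<rparr>"

text \<open>The bound \<open>n > 4\<close> excludes the loops that arise when \<open>n\<close> divides \<open>1\<close> or \<open>4\<close>.\<close>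

lemma simple_graph_circulant_1_4:
  assumes "n > 4"
  shows "simple_graph (circulant_1_4 n)"
proof -
  have ne: "(u + d) mod n \<noteq> u" if "d \<in> {1, -1, 4, -4}" for u d
  proof
    assume "(u + d) mod n = u"
    then have "(u + d) mod n = u mod n" by (metis mod_mod_trivial)
    then have "n dvd d" by (simp add: mod_eq_dvd_iff)
    then have "\<bar>n\<bar> \<le> \<bar>d\<bar>" using that by (intro dvd_imp_le_int) auto
    then show False using that assms by auto
  qed
  have "\<exists>u\<in>{0..<n}. \<exists>v\<in>{0..<n}. u \<noteq> v \<and> {x, y} = {u, v}"
    if x: "x \<in> {0..<n}"
      and y: "y \<in> {(x + 1) mod n, (x - 1) mod n, (x + 4) mod n, (x - 4) mod n}" for x y
  proof -
    have "x \<noteq> y" using y ne[of 1 x] ne[of "-1" x] ne[of 4 x] ne[of "-4" x] by auto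
    moreover have "y \<in> {0..<n}" using y assms by auto
    ultimately show ?thesis using x by blast
  qed
  then show ?thesis unfolding simple_graph_def circulant_1_4_def by fastforce
qed

lemma open_nbhd_circulant_1_4:
  assumes u: "u \<in> {0..<n}"
  shows "{v. {u, v} \<in> edges (circulant_1_4 n)} =
    {(u + 1) mod n, (u - 1) mod n, (u + 4) mod n, (u - 4) mod n}" (is "?L = ?R")
proof
  have inv: "u = (v - d) mod n" if "v = (u + d) mod n" "u \<in> {0..<n}" for u v d :: int
    using that by (simp add: mod_simps)
  show "?L \<subseteq> ?R"
  proof
    fix v assume "v \<in> ?L"
    then obtain x y where xy: "{u, v} = {x, y}" "x \<in> {0..<n}"
      "y \<in> {(x + 1) mod n, (x - 1) mod n, (x + 4) mod n, (x - 4) mod n}"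
      unfolding circulant_1_4_def by auto
    have "x \<in> {(y + 1) mod n, (y - 1) mod n, (y + 4) mod n, (y - 4) mod n}"
      using xy(2,3) inv[of y x 1] inv[of y x "-1"] inv[of y x 4] inv[of y x "-4"] by auto
    then show "v \<in> ?R" using xy(1,3) by (auto simp: doubleton_eq_iff)
  qed
  show "?R \<subseteq> ?L" using u unfolding circulant_1_4_def by auto
qed

end

theory Submission
  imports Defs
begin

text \<open>
  Let \<open>n = 2k + 1\<close> and let \<open>S\<close> be the complement of a self-identifying code. Comparing \<open>u\<close> with
  \<open>u + d\<close> for \<open>d = \<plusminus>1, \<plusminus>3, \<plusminus>4, \<plusminus>5\<close> shows that \<open>S\<close> contains no translate of eight triples; in
  particular, if \<open>x\<close> and \<open>x + 5\<close> lie in \<open>S\<close>, then \<open>x - 3, x + 1, x + 2, x + 3, x + 4, x + 8\<close> do not.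
  Let \<open>P\<close> and \<open>Q\<close> consist of those \<open>x\<close> for which both, respectively none, of \<open>x\<close> and \<open>x + 5\<close>
  lie in \<open>S\<close>. Then \<open>n + |P| = |Q| + 2|S|\<close>, and \<open>P + 3\<close> and \<open>P - 3\<close> are subsets of \<open>Q\<close>, so that
  \<open>2|S| \<le> n\<close>. As \<open>n\<close> is odd, it remains to exclude \<open>|Q| = |P| + 1\<close>. If \<open>P\<close> is nonempty, this
  equation forces \<open>Q = (P + 3) \<union> (P - 3)\<close>, whence \<open>P + 7 \<subseteq> P\<close>, while the overlap of \<open>P + 3\<close>
  and \<open>P - 3\<close> provides \<open>y\<close> and \<open>y + 6\<close> in \<open>P\<close>, which is absurd. If \<open>P\<close> is empty, \<open>S\<close> alternates
  along steps of \<open>5\<close> except at one place \<open>q\<close>; then two consecutive elements of \<open>S\<close> occur near \<open>q\<close>,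
  and they propagate to a run of length \<open>6\<close>, contradicting \<open>P = {}\<close>.

  The bound is attained by the complement of \<open>{0, 2, \<dots>, 2k - 4}\<close>.
\<close>

section \<open>Self-identification in terms of divisibility\<close>

definition offsets :: "int set" where
  "offsets = {0, 1, -1, 4, -4}"

lemma mod_eq_if_in_range:
  fixes c n x :: int
  assumes "c \<in> {0..<n}"
  shows "c = x mod n \<longleftrightarrow> n dvd c - x"
  using assms by (metis atLeastLessThan_iff mod_eq_dvd_iff mod_pos_pos_trivial)

lemma closed_nbhd_circulant_1_4_iff:
  assumes "u \<in> {0..<n}" "c \<in> {0..<n}"
  shows "c \<in> closed_nbhd (circulant_1_4 n) u \<longleftrightarrow> (\<exists>d\<in>offsets. n dvd c - u - d)"
proof -
  have *: "n dvd c - u - d \<longleftrightarrow> c = (u + d) mod n" for d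
    using mod_eq_if_in_range[OF assms(2), of "u + d"] by (simp add: algebra_simps)
  have "u mod n = u" using assms by simp
  then show ?thesis
    unfolding closed_nbhd_def open_nbhd_circulant_1_4[OF assms(1)] offsets_def * by auto
qed

text \<open>Separation depends on \<open>u\<close> and \<open>v\<close> only modulo
  \<open>n\<close>, so it may be quantified over all integers; later shifts then need no
  reduction.\<close>

lemma self_identifying_code_circulant_1_4_iff:
  assumes n: "n > 1" and C: "C \<subseteq> {0..<n}"
  shows "self_identifying_code (circulant_1_4 n) C \<longleftrightarrow>
    (\<forall>u v. \<not> n dvd u - v \<longrightarrow>
      (\<exists>d\<in>offsets. (u + d) mod n \<in> C \<and> (\<forall>e\<in>offsets. \<not> n dvd u + d - v - e)))"
    (is "?L \<longleftrightarrow> ?R")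
proof -
  let ?G = "circulant_1_4 n"
  have verts: "verts ?G = {0..<n}" by (simp add: circulant_1_4_def)
  have sep: "I_set ?G C u - I_set ?G C v \<noteq> {} \<longleftrightarrow>
      (\<exists>d\<in>offsets. (u + d) mod n \<in> C \<and> (\<forall>e\<in>offsets. \<not> n dvd u + d - v - e))"
    if u: "u \<in> {0..<n}" and v: "v \<in> {0..<n}" for u v
  proof -
    have "I_set ?G C u - I_set ?G C v \<noteq> {} \<longleftrightarrow>
      (\<exists>c\<in>C. (\<exists>d\<in>offsets. n dvd c - u - d) \<and> (\<forall>e\<in>offsets. \<not> n dvd c - v - e))"
      unfolding I_set_def using closed_nbhd_circulant_1_4_iff[OF u] closed_nbhd_circulant_1_4_iff[OF v] C
      by blast
    also have "\<dots> \<longleftrightarrow> (\<exists>c\<in>C. \<exists>d\<in>offsets. c = (u + d) mod n \<and> (\<forall>e\<in>offsets. \<not> n dvd c - v - e))"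
      using C mod_eq_if_in_range[of _ n] by (auto simp: diff_diff_eq subset_iff)
    also have "\<dots> \<longleftrightarrow>
        (\<exists>d\<in>offsets. (u + d) mod n \<in> C \<and> (\<forall>e\<in>offsets. \<not> n dvd (u + d) mod n - v - e))"
      by blast
    finally show ?thesis by (simp add: dvd_eq_mod_eq_0 mod_simps diff_diff_eq)
  qed
  show ?thesis
  proof
    assume L: ?L
    show ?R
    proof (intro allI impI)
      fix u v assume "\<not> n dvd u - v"
      then have "u mod n \<noteq> v mod n" by (simp add: mod_eq_dvd_iff)
      then have "\<exists>d\<in>offsets. (u mod n + d) mod n \<in> C \<and>
          (\<forall>e\<in>offsets. \<not> n dvd u mod n + d - v mod n - e)"
        using L n sep[of "u mod n" "v mod n"] by (simp add: self_identifying_code_def verts)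
      moreover have "n dvd u mod n + d - v mod n - e \<longleftrightarrow> n dvd u + d - v - e" for d e
        unfolding dvd_eq_mod_eq_0
        by (intro arg_cong[of _ _ "\<lambda>x. x = 0"] mod_diff_cong mod_add_cong) auto
      ultimately show "\<exists>d\<in>offsets. (u + d) mod n \<in> C \<and> (\<forall>e\<in>offsets. \<not> n dvd u + d - v - e)"
        by (simp add: mod_simps)
    qed
  next
    assume R: ?R
    have "\<not> n dvd 0 - 1" using n by simp
    then have "C \<noteq> {}" using R by blast
    moreover have "\<not> n dvd u - v" if "u \<in> {0..<n}" "v \<in> {0..<n}" "u \<noteq> v" for u v
      using that mod_eq_if_in_range[of u n v] by simp
    ultimately show ?L
      using R C sep by (simp add: self_identifying_code_def is_code_def verts)
  qed
qed

section \<open>Periodic sets without the forbidden triples\<close>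

lemma card_shift_periodic:
  fixes n :: int
  assumes n: "n > 0" and per: "\<And>x. p (x mod n) = p x"
  shows "card {x \<in> {0..<n}. p (x + c)} = card {x \<in> {0..<n}. p x}"
proof (rule bij_betw_same_card[of "\<lambda>x. (x + c) mod n"],
    rule bij_betw_byWitness[where f' = "\<lambda>x. (x - c) mod n"])
  show "\<forall>a\<in>{x \<in> {0..<n}. p (x + c)}. ((a + c) mod n - c) mod n = a"
    by (simp add: mod_simps)
  show "\<forall>a\<in>{x \<in> {0..<n}. p x}. ((a - c) mod n + c) mod n = a"
    by (simp add: mod_simps)
  show "(\<lambda>x. (x + c) mod n) ` {x \<in> {0..<n}. p (x + c)} \<subseteq> {x \<in> {0..<n}. p x}"
    using n by (auto simp: per)
  have "p ((x - c) mod n + c) = p x" for x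
    using per[of "(x - c) mod n + c"] per[of x] by (simp add: mod_simps)
  then show "(\<lambda>x. (x - c) mod n) ` {x \<in> {0..<n}. p x} \<subseteq> {x \<in> {0..<n}. p (x + c)}"
    using n by auto
qed

text \<open>\<open>s\<close> stands for the complement of a code, lifted to an
  \<open>n\<close>-periodic predicate on the integers. Each triple is what the integer neighbourhood
  of some \<open>u\<close> does not share with that of \<open>u + d\<close>; \<open>13\<close> is
  the least \<open>2k + 1\<close> with \<open>k > 5\<close>.\<close>

locale triple_free =
  fixes n :: int and s :: "int \<Rightarrow> bool"
  assumes n_ge: "n \<ge> 13" and odd_n: "odd n"
    and periodic: "s (x mod n) = s x"
    and free_0_3_8: "\<not> (s x \<and> s (x + 3) \<and> s (x + 8))"
    and free_0_5_8: "\<not> (s x \<and> s (x + 5) \<and> s (x + 8))"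
    and free_0_4_5: "\<not> (s x \<and> s (x + 4) \<and> s (x + 5))"
    and free_0_1_5: "\<not> (s x \<and> s (x + 1) \<and> s (x + 5))"
    and free_0_3_5: "\<not> (s x \<and> s (x + 3) \<and> s (x + 5))"
    and free_0_2_5: "\<not> (s x \<and> s (x + 2) \<and> s (x + 5))"
    and free_0_3_4: "\<not> (s x \<and> s (x + 3) \<and> s (x + 4))"
    and free_0_1_4: "\<not> (s x \<and> s (x + 1) \<and> s (x + 4))"
begin

definition both :: "int \<Rightarrow> bool" where
  "both x \<longleftrightarrow> s x \<and> s (x + 5)"

definition neither :: "int \<Rightarrow> bool" where
  "neither x \<longleftrightarrow> \<not> s x \<and> \<not> s (x + 5)"

lemma s_shift_mod: "s (x mod n + c) = s (x + c)"
  using periodic[of "x mod n + c"] periodic[of "x + c"] by (simp add: mod_simps)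

lemma both_mod: "both (x mod n + c) = both (x + c)"
  using s_shift_mod[of x c] s_shift_mod[of x "c + 5"] by (simp add: both_def algebra_simps)

lemma neither_mod: "neither (x mod n + c) = neither (x + c)"
  using s_shift_mod[of x c] s_shift_mod[of x "c + 5"] by (simp add: neither_def algebra_simps)

lemma both_periodic: "both (x mod n) = both x"
  using both_mod[of x 0] by simp

lemma neither_periodic: "neither (x mod n) = neither x"
  using neither_mod[of x 0] by simp

lemma not_dvd_small: "c \<noteq> 0 \<Longrightarrow> \<bar>c\<bar> < 13 \<Longrightarrow> \<not> n dvd c"
  using n_ge dvd_imp_le_int[of c n] by auto

lemma bothD:
  assumes "both x"
  shows "s x" "s (x + 5)" "\<not> s (x + 1)" "\<not> s (x + 2)" "\<not> s (x + 3)" "\<not> s (x + 4)"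
    "\<not> s (x + 8)" "\<not> s (x - 3)"
  using assms free_0_1_5[of x] free_0_2_5[of x] free_0_3_5[of x] free_0_4_5[of x] free_0_5_8[of x]
    free_0_3_8[of "x - 3"]
  by (auto simp: both_def algebra_simps)

lemma both_imp_neither:
  assumes "both x"
  shows "neither (x + 3)" "neither (x - 3)"
  using bothD[OF assms] by (auto simp: neither_def algebra_simps)

text \<open>Pointwise, \<open>[s x] + [s (x + 5)] = 1 + [both x] - [neither x]\<close>, and the two
  terms on the left have the same sum over a period.\<close>

lemma double_count:
  "n + int (card {x \<in> {0..<n}. both x}) =
    int (card {x \<in> {0..<n}. neither x}) + 2 * int (card {x \<in> {0..<n}. s x})"
proof -
  have "int (card {x \<in> {0..<n}. p x}) = (\<Sum>x\<in>{0..<n}. of_bool (p x))" for p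
    by (simp add: sum.If_cases of_bool_def Int_def)
  note count = this
  have "(\<Sum>x\<in>{0..<n}. of_bool (s (x + 5))) = (\<Sum>x\<in>{0..<n}. of_bool (s x) :: int)"
    using card_shift_periodic[of n s 5] n_ge periodic by (simp flip: count)
  then have "2 * (\<Sum>x\<in>{0..<n}. of_bool (s x) :: int) =
      (\<Sum>x\<in>{0..<n}. of_bool (s x) + of_bool (s (x + 5)))"
    by (simp add: sum.distrib)
  also have "\<dots> = (\<Sum>x\<in>{0..<n}. 1 + of_bool (both x) - of_bool (neither x))"
    by (rule sum.cong) (auto simp: both_def neither_def)
  also have "\<dots> = n + (\<Sum>x\<in>{0..<n}. of_bool (both x)) - (\<Sum>x\<in>{0..<n}. of_bool (neither x))"
    using n_ge by (simp add: sum.distrib sum_subtractf)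
  finally show ?thesis unfolding count by simp
qed

text \<open>As \<open>n\<close> is odd, \<open>(n + 1) / 2\<close> steps of \<open>6\<close> amount
  to \<open>3\<close> modulo \<open>n\<close>, but \<open>both x\<close> rules out
  \<open>s (x + 3)\<close>.\<close>

lemma no_both_6_periodic:
  assumes step: "\<And>x. both x \<Longrightarrow> both (x + 6)"
  shows "\<not> both x"
proof
  assume x: "both x"
  have "both (x + 6 * int j)" for j
  proof (induction j)
    case (Suc j)
    then show ?case using step[of "x + 6 * int j"] by (simp add: algebra_simps)
  qed (use x in simp)
  from this[of "nat ((n + 1) div 2)"] have "both (x + 3 * (n + 1))"
    using n_ge odd_n by (auto elim!: oddE simp: algebra_simps)
  moreover have "(x + 3 * (n + 1)) mod n = (x + 3) mod n"
    by (simp add: mod_eq_dvd_iff algebra_simps)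
  ultimately have "both (x + 3)" by (metis both_periodic)
  then show False using bothD[OF x] by (simp add: both_def)
qed

lemma card_neither_ge:
  assumes x: "both x"
  shows "card {x \<in> {0..<n}. neither x} \<ge> card {x \<in> {0..<n}. both x} + 2"
proof (rule ccontr)
  define A where "A = {x \<in> {0..<n}. both (x - 3)}"
  define B where "B = {x \<in> {0..<n}. both (x + 3)}"
  define P where "P = {x \<in> {0..<n}. both x}"
  define Q where "Q = {x \<in> {0..<n}. neither x}"
  assume "\<not> card {x \<in> {0..<n}. neither x} \<ge> card {x \<in> {0..<n}. both x} + 2"
  then have small: "card Q \<le> card P + 1" by (simp add: P_def Q_def)
  have "finite {x \<in> {0..<n}. p x}" for p
    by (rule finite_subset[of _ "{0..<n}"]) auto
  note fin = this[of "\<lambda>x. both (x - 3)", folded A_def] this[of "\<lambda>x. both (x + 3)", folded B_def]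
    this[of both, folded P_def] this[of neither, folded Q_def]
  have cards: "card A = card P" "card B = card P"
    using card_shift_periodic[of n both "-3"] card_shift_periodic[of n both 3] n_ge both_periodic
    by (simp_all add: A_def B_def P_def)
  have sub: "A \<union> B \<subseteq> Q"
    using both_imp_neither[of "_ - 3"] both_imp_neither[of "_ + 3"]
    by (auto simp: A_def B_def Q_def)
  have "A \<noteq> B"
  proof
    assume eq: "A = B"
    have "both (y + 6)" if "both y" for y
    proof -
      have "(y + 3) mod n \<in> A"
        using that both_mod[of "y + 3" "-3"] n_ge by (simp add: A_def)
      then have "both ((y + 3) mod n + 3)" using eq by (simp add: B_def)
      then show ?thesis using both_mod[of "y + 3" 3] by (simp add: algebra_simps)
    qed
    then show False using no_both_6_periodic x by blast
  qed
  \<comment> \<open>Two distinct sets of size \<open>card P\<close> have a union of size at least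
    \<open>card P + 1\<close>, which is all that \<open>small\<close> leaves to
    \<open>Q\<close>.\<close>
  then have "A \<subset> A \<union> B" using card_subset_eq[of A B] fin cards by auto
  then have "card P < card (A \<union> B)" using psubset_card_mono fin cards by (metis finite_UnI)
  then have card_un: "card (A \<union> B) = card P + 1" and Q_eq: "Q = A \<union> B"
    using card_mono[OF fin(4) sub] card_subset_eq[OF fin(4) sub] small by auto
  have neitherD: "both (y - 3) \<or> both (y + 3)" if "neither y" for y
  proof -
    have "y mod n \<in> Q" using that n_ge neither_periodic by (simp add: Q_def)
    then show ?thesis
      using Q_eq both_mod[of y "-3"] both_mod[of y 3] by (auto simp: A_def B_def)
  qed
  have step: "both (y + 7)" if y: "both y" for y
  proof -
    note D = bothD[OF y]
    \<comment> \<open>Each possible partner at distance \<open>3\<close> clashes with a known value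
      of \<open>s\<close>, which forces \<open>s (y + 6)\<close> and then \<open>s (y + 7)\<close>;
      at \<open>y + 4\<close> only the partner \<open>y + 7\<close> survives.\<close>
    have "\<not> neither (y + 1)"
      using neitherD[of "y + 1"] bothD(2)[of "y - 2"] bothD(1)[of "y + 4"] D
      by (auto simp: algebra_simps)
    then have s6: "s (y + 6)" using D by (simp add: neither_def algebra_simps)
    have "\<not> neither (y + 2)"
      using neitherD[of "y + 2"] bothD(2)[of "y - 1"] bothD(3)[of "y + 5"] D s6
      by (auto simp: algebra_simps)
    then have s7: "s (y + 7)" using D by (simp add: neither_def algebra_simps)
    have "neither (y + 4)"
      using free_0_1_4[of "y + 5"] D s6 s7 by (auto simp: neither_def algebra_simps)
    then show ?thesis
      using neitherD[of "y + 4"] bothD(1)[of "y + 1"] D by (auto simp: algebra_simps)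
  qed
  have "{x mod n, (x + 7) mod n} \<subseteq> P"
    using x step n_ge both_periodic by (simp add: P_def)
  moreover have "x mod n \<noteq> (x + 7) mod n"
    using not_dvd_small[of "-7"] by (simp add: mod_eq_dvd_iff)
  ultimately have "card P \<ge> 2"
    using card_mono[OF fin(3), of "{x mod n, (x + 7) mod n}"] by simp
  \<comment> \<open>The intersection has \<open>2 * card P - (card P + 1)\<close> elements.\<close>
  then have "card (A \<inter> B) \<noteq> 0"
    using card_Un_Int[OF fin(1,2)] cards card_un by simp
  then have "A \<inter> B \<noteq> {}" by force
  then obtain z where "z \<in> A" "z \<in> B" by blast
  then have "both (z - 3)" "both (z + 3)" by (auto simp: A_def B_def)
  \<comment> \<open>\<open>step\<close> leads from \<open>z - 3\<close> to
    \<open>both (z + 4)\<close>, while \<open>both (z + 3)\<close> forbids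
    \<open>s (z + 4)\<close>.\<close>
  then show False
    using step[of "z - 3"] bothD(3)[of "z + 3"] bothD(1)[of "z + 4"] by (simp add: algebra_simps)
qed

lemma ex_both_if_card_neither_1:
  assumes "card {x \<in> {0..<n}. neither x} = 1"
  shows "\<exists>x. both x"
proof (rule ccontr)
  assume no: "\<nexists>x. both x"
  obtain q where q: "{x \<in> {0..<n}. neither x} = {q}"
    using assms by (auto simp: card_1_singleton_iff)
  then have "neither q" by auto
  then have q0: "\<not> s q" "\<not> s (q + 5)" by (auto simp: neither_def)
  have hit: "s (x + 5) \<longleftrightarrow> \<not> s x" if "\<not> n dvd x - q" for x
  proof -
    have "\<not> neither x"
    proof
      assume "neither x"
      then have "x mod n \<in> {q}" unfolding q[symmetric] using n_ge neither_periodic by simp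
      then show False using that by (auto simp: mod_eq_dvd_iff)
    qed
    then show ?thesis using no by (auto simp: both_def neither_def)
  qed
  \<comment> \<open>A forbidden triple turns two consecutive elements into a non-element, and
    \<open>hit\<close> flips it five places away. The excluded \<open>c\<close> is the one for which
    \<open>hit\<close> would be applied at \<open>q\<close>.\<close>
  have up: "s (q + (c + 2))" if "s (q + c)" "s (q + (c + 1))" "c \<noteq> 3" "\<bar>c - 3\<bar> < 13" for c
    using that free_0_3_4[of "q + (c - 3)"] hit[of "q + (c - 3)"] not_dvd_small[of "c - 3"]
    by (simp add: algebra_simps)
  have down: "s (q + (c - 1))" if "s (q + c)" "s (q + (c + 1))" "c \<noteq> 1" "\<bar>c - 1\<bar> < 13" for c
    using that free_0_1_4[of "q + c"] hit[of "q + (c - 1)"] not_dvd_small[of "c - 1"]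
    by (simp add: algebra_simps)
  have hitq: "s (q + (c + 5)) \<longleftrightarrow> \<not> s (q + c)" if "c \<noteq> 0" "\<bar>c\<bar> < 13" for c
    using hit[of "q + c"] not_dvd_small[OF that] by (simp add: algebra_simps)
  show False
  \<comment> \<open>The case decides whether a consecutive pair arises above \<open>q\<close> or
    below it. The run then grows away from \<open>q\<close> until its ends are \<open>5\<close>
    apart.\<close>
  proof (cases "s (q + 6)")
    case False
    then have "s (q + 10)" "s (q + 11)" using hitq[of 5] hitq[of 6] q0 by auto
    moreover from this have "s (q + 12)" using up[of 10] by simp
    moreover from calculation have "s (q + 13)" using up[of 11] by simp
    moreover from calculation have "s (q + 14)" using up[of 12] by simp
    moreover from calculation have "s (q + 15)" using up[of 13] by simp
    ultimately show False using no by (auto simp: both_def algebra_simps dest: spec[of _ "q + 10"])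
  next
    case True
    then have "s (q - 5)" "s (q - 4)" using hitq[of "-5"] hitq[of "-4"] hitq[of 1] q0 by auto
    moreover from this have "s (q - 6)" using down[of "-5"] by simp
    moreover from calculation have "s (q - 7)" using down[of "-6"] by simp
    moreover from calculation have "s (q - 8)" using down[of "-7"] by simp
    moreover from calculation have "s (q - 9)" using down[of "-8"] by simp
    ultimately show False using no by (auto simp: both_def dest: spec[of _ "q - 9"])
  qed
qed

text \<open>By \<open>double_count\<close> and the parity of \<open>n\<close>, a violation makes
  \<open>?Q - ?P\<close> odd and at most \<open>1\<close>. A nonempty \<open>both\<close> needs
  \<open>2\<close>, so \<open>?P = 0\<close> and \<open>?Q = 1\<close> remain.\<close>

lemma card_le: "2 * int (card {x \<in> {0..<n}. s x}) + 3 \<le> n"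
proof (rule ccontr)
  let ?P = "card {x \<in> {0..<n}. both x}" and ?Q = "card {x \<in> {0..<n}. neither x}"
  assume "\<not> ?thesis"
  then have less: "int ?Q < int ?P + 3" using double_count by linarith
  have "odd (int ?Q - int ?P)" using double_count odd_n by presburger
  then have less2: "?Q \<le> ?P + 1" using less by presburger
  then have none: "\<not> both x" for x using card_neither_ge[of x] by auto
  then have "?P = 0" by simp
  then have "?Q = 1" using less2 \<open>odd (int ?Q - int ?P)\<close> by (cases ?Q) auto
  then show False using ex_both_if_card_neither_1 none by blast
qed

end

section \<open>Lower bound for codes\<close>

lemma card_self_identifying_code_ge:
  assumes n: "n \<ge> 13" "odd n" and C: "self_identifying_code (circulant_1_4 n) C"
  shows "2 * int (card C) \<ge> n + 3"
proof -
  have sub: "C \<subseteq> {0..<n}"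
    using C by (simp add: self_identifying_code_def is_code_def circulant_1_4_def)
  define s where "s x \<longleftrightarrow> x mod n \<notin> C" for x
  have sep: "\<exists>e\<in>offsets. \<not> s (u + e) \<and> e - d \<notin> offsets" if "d \<noteq> 0" "\<bar>d\<bar> < 13" for u d
  proof -
    have "\<not> n dvd u - (u + d)" using that n dvd_imp_le_int[of d n] by auto
    moreover have "n > 1" using n by simp
    ultimately obtain e where "e \<in> offsets" "(u + e) mod n \<in> C"
      "\<forall>f\<in>offsets. \<not> n dvd u + e - (u + d) - f"
      using C self_identifying_code_circulant_1_4_iff[OF _ sub] by blast
    \<comment> \<open>If \<open>e - d\<close> were an offset, the choice \<open>f = e - d\<close>
      would give the dividend \<open>0\<close>.\<close>
    then show ?thesis by (intro bexI[of _ e]) (auto simp: s_def dest: bspec[of _ _ "e - d"])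
  qed
  interpret triple_free n s
  proof
    fix x
    show "s (x mod n) = s x" by (simp add: s_def)
    \<comment> \<open>In each case \<open>u\<close> is chosen so that \<open>x\<close> is the least
      of the three \<open>u + e\<close> with \<open>e - d\<close> outside
      \<open>offsets\<close>.\<close>
    show "\<not> (s x \<and> s (x + 3) \<and> s (x + 8))"
      using sep[of 1 "x + 4"] by (auto simp: offsets_def algebra_simps)
    show "\<not> (s x \<and> s (x + 5) \<and> s (x + 8))"
      using sep[of "-1" "x + 4"] by (auto simp: offsets_def algebra_simps)
    show "\<not> (s x \<and> s (x + 4) \<and> s (x + 5))"
      using sep[of 3 "x + 4"] by (auto simp: offsets_def algebra_simps)
    show "\<not> (s x \<and> s (x + 1) \<and> s (x + 5))"
      using sep[of "-3" "x + 1"] by (auto simp: offsets_def algebra_simps)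
    show "\<not> (s x \<and> s (x + 3) \<and> s (x + 5))"
      using sep[of 4 "x + 4"] by (auto simp: offsets_def algebra_simps)
    show "\<not> (s x \<and> s (x + 2) \<and> s (x + 5))"
      using sep[of "-4" "x + 1"] by (auto simp: offsets_def algebra_simps)
    show "\<not> (s x \<and> s (x + 3) \<and> s (x + 4))"
      using sep[of 5 "x + 4"] by (auto simp: offsets_def algebra_simps)
    show "\<not> (s x \<and> s (x + 1) \<and> s (x + 4))"
      using sep[of "-5" x] by (auto simp: offsets_def algebra_simps)
  qed (use n in auto)
  have "{x \<in> {0..<n}. s x} = {0..<n} - C" by (auto simp: s_def)
  then have "int (card {x \<in> {0..<n}. s x}) = n - int (card C)"
    using n sub card_mono[OF _ sub] by (simp add: card_Diff_subset finite_subset[OF sub])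
  then show ?thesis using card_le by linarith
qed

section \<open>A code attaining the bound\<close>

definition optimal_code :: "int \<Rightarrow> int set" where
  "optimal_code k = (\<lambda>i. 2 * i + 1) ` {0..<k} \<union> {2 * k - 2, 2 * k}"

lemma card_optimal_code:
  assumes "k > 0"
  shows "int (card (optimal_code k)) = k + 2"
proof -
  have "card ((\<lambda>i. 2 * i + 1) ` {0..<k}) = nat k"
    by (simp add: card_image inj_on_def)
  moreover have "(\<lambda>i. 2 * i + 1) ` {0..<k} \<inter> {2 * k - 2, 2 * k} = {}"
    by (auto, presburger+)
  ultimately show ?thesis
    using assms unfolding optimal_code_def by (subst card_Un_disjoint) auto
qed

lemma optimal_code_iff:
  "x \<in> optimal_code k \<longleftrightarrow> 0 \<le> x \<and> x < 2 * k \<and> odd x \<or> x = 2 * k - 2 \<or> x = 2 * k"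
  unfolding optimal_code_def by (auto simp: image_iff elim!: oddE)

text \<open>Four patterns, such as \<open>{u - 1, u + 1}\<close>, lie in the closed neighbourhood of
  \<open>u\<close> and of no other vertex; the code contains one of them at every
  \<open>u\<close>.\<close>

lemma self_identifying_optimal_code:
  assumes k: "k > 5"
  shows "self_identifying_code (circulant_1_4 (2 * k + 1)) (optimal_code k)"
proof -
  define n where "n = 2 * k + 1"
  define t where "t x \<longleftrightarrow> x mod n \<in> optimal_code k" for x
  have n13: "n \<ge> 13" using k by (simp add: n_def)
  have small: "c = 0" if "n dvd c" "\<bar>c\<bar> < 13" for c
    using that n13 dvd_imp_le_int[of c n] by fastforce
  have t_low: "t x \<longleftrightarrow> odd x \<or> x \<ge> 2 * k - 2" if "0 \<le> x" "x < n" for x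
    using that unfolding t_def by (auto simp: optimal_code_iff n_def)
  have t_neg: "t x \<longleftrightarrow> t (x + n)" and t_high: "t x \<longleftrightarrow> t (x - n)" for x
    by (simp_all add: t_def)
  have cases: "t (u - 1) \<and> t (u + 1) \<or> t u \<and> t (u - 4) \<and> t (u + 4) \<or>
      t u \<and> t (u - 1) \<and> t (u + 4) \<or> t u \<and> t (u + 1) \<and> t (u - 4)"
    if u: "0 \<le> u" "u < n" for u
  proof -
    \<comment> \<open>Odd elements suffice in the fourth and fifth cases; the others, near the seam
      at \<open>0\<close>, use \<open>2k - 2\<close> or \<open>2k\<close>.\<close>
    consider "u = 0" | "u = 1" | "u = 3" | "even u" "2 \<le> u" "u \<le> 2 * k - 2"
      | "odd u" "5 \<le> u" "u \<le> 2 * k - 5" | "u = 2 * k - 3" | "u = 2 * k - 1" | "u = 2 * k"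
      using u unfolding n_def by atomize_elim presburger
    then show ?thesis
    proof cases
      case 1
      then show ?thesis using k t_low[of 1] t_neg[of "-1"] t_low[of "2 * k"] by (simp add: n_def)
    next
      case 2
      then show ?thesis using k t_low[of 1] t_low[of 5] t_neg[of "-3"] t_low[of "2 * k - 2"]
        by (simp add: n_def)
    next
      case 3
      then show ?thesis using k t_low[of 3] t_low[of 7] t_neg[of "-1"] t_low[of "2 * k"]
        by (simp add: n_def)
    next
      case 4
      then show ?thesis using k t_low[of "u - 1"] t_low[of "u + 1"] by (simp add: n_def)
    next
      case 5
      then show ?thesis using k t_low[of u] t_low[of "u - 4"] t_low[of "u + 4"]
        by (simp add: n_def)
    next
      case 6
      then show ?thesis using k t_low[of u] t_low[of "u + 1"] t_low[of "u - 4"]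
        by (simp add: n_def)
    next
      case 7
      then show ?thesis using k t_low[of "u - 1"] t_low[of "u + 1"] by (simp add: n_def)
    next
      case 8
      then show ?thesis using k t_low[of u] t_low[of "u - 1"] t_low[of 3] t_high[of "u + 4"]
        by (simp add: n_def)
    qed
  qed
  have "\<exists>d\<in>offsets. t (u + d) \<and> (\<forall>e\<in>offsets. \<not> n dvd u + d - v - e)"
    if uv: "\<not> n dvd u - v" for u v
  proof (rule ccontr)
    assume "\<not> ?thesis"
    then have cov: "\<exists>e\<in>offsets. n dvd (u - v) + (d - e)" if "d \<in> offsets" "t (u + d)" for d
      using that by (force simp: algebra_simps)
    \<comment> \<open>All shifts \<open>d - e\<close> are congruent to \<open>v - u\<close>. In the
      three-element patterns, comparison with the centre \<open>0\<close> keeps their gap at most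
      \<open>4 + 8 = 12\<close>, so congruent shifts coincide.\<close>
    have agree: "d - e = d' - e'"
      if "n dvd (u - v) + (d - e)" "n dvd (u - v) + (d' - e')" "\<bar>(d - e) - (d' - e')\<bar> < 13"
      for d e d' e'
      using dvd_diff[OF that(1,2)] small[of "(d - e) - (d' - e')"] that(3) by simp
    have mem: "0 \<in> offsets" "1 \<in> offsets" "- 1 \<in> offsets" "4 \<in> offsets" "- 4 \<in> offsets"
      by (simp_all add: offsets_def)
    have nz: "d \<noteq> e" if "n dvd (u - v) + (d - e)" for d e using uv that by auto
    have t_mod: "t (u mod n + d) \<longleftrightarrow> t (u + d)" for d by (simp add: t_def mod_simps)
    have "t (u + - 1) \<and> t (u + 1) \<or> t (u + 0) \<and> t (u + - 4) \<and> t (u + 4) \<or>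
      t (u + 0) \<and> t (u + - 1) \<and> t (u + 4) \<or> t (u + 0) \<and> t (u + 1) \<and> t (u + - 4)"
      using cases[of "u mod n"] n13 t_mod[of 0] t_mod[of 1] t_mod[of 4] t_mod[of "-1"] t_mod[of "-4"]
      by simp
    then show False
    proof (elim disjE conjE)
      assume t: "t (u + - 1)" "t (u + 1)"
      obtain a where a: "a \<in> offsets" "n dvd (u - v) + (- 1 - a)"
        using cov[OF mem(3) t(1)] by blast
      obtain b where b: "b \<in> offsets" "n dvd (u - v) + (1 - b)"
        using cov[OF mem(2) t(2)] by blast
      show False
        using agree[OF a(2) b(2)] nz[OF a(2)] a(1) b(1)
        by (auto simp: offsets_def)
    next
      assume t: "t (u + 0)" "t (u + - 4)" "t (u + 4)"
      obtain a where a: "a \<in> offsets" "n dvd (u - v) + (0 - a)"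
        using cov[OF mem(1) t(1)] by blast
      obtain b where b: "b \<in> offsets" "n dvd (u - v) + (- 4 - b)"
        using cov[OF mem(5) t(2)] by blast
      obtain c where c: "c \<in> offsets" "n dvd (u - v) + (4 - c)"
        using cov[OF mem(4) t(3)] by blast
      show False
        using agree[OF a(2) b(2)] agree[OF a(2) c(2)] nz[OF a(2)] a(1) b(1) c(1)
        by (auto simp: offsets_def)
    next
      assume t: "t (u + 0)" "t (u + - 1)" "t (u + 4)"
      obtain a where a: "a \<in> offsets" "n dvd (u - v) + (0 - a)"
        using cov[OF mem(1) t(1)] by blast
      obtain b where b: "b \<in> offsets" "n dvd (u - v) + (- 1 - b)"
        using cov[OF mem(3) t(2)] by blast
      obtain c where c: "c \<in> offsets" "n dvd (u - v) + (4 - c)"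
        using cov[OF mem(4) t(3)] by blast
      show False
        using agree[OF a(2) b(2)] agree[OF a(2) c(2)] nz[OF a(2)] a(1) b(1) c(1)
        by (auto simp: offsets_def)
    next
      assume t: "t (u + 0)" "t (u + 1)" "t (u + - 4)"
      obtain a where a: "a \<in> offsets" "n dvd (u - v) + (0 - a)"
        using cov[OF mem(1) t(1)] by blast
      obtain b where b: "b \<in> offsets" "n dvd (u - v) + (1 - b)"
        using cov[OF mem(2) t(2)] by blast
      obtain c where c: "c \<in> offsets" "n dvd (u - v) + (- 4 - c)"
        using cov[OF mem(5) t(3)] by blast
      show False
        using agree[OF a(2) b(2)] agree[OF a(2) c(2)] nz[OF a(2)] a(1) b(1) c(1)
        by (auto simp: offsets_def)
    qed
  qed
  then show ?thesis
    using self_identifying_code_circulant_1_4_iff[of n "optimal_code k"] k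
    by (auto simp: n_def t_def optimal_code_iff subset_iff)
qed

theorem theorem9:
  fixes k :: int
  assumes "k > 5"
  shows "int (gamma_SID (circulant_1_4 (2 * k + 1))) = k + 2"
proof -
  let ?G = "circulant_1_4 (2 * k + 1)"
  \<comment> \<open>\<open>Min\<close> is the minimum only of a finite set.\<close>
  have "{card C | C. self_identifying_code ?G C} \<subseteq> card ` Pow {0..<2 * k + 1}"
    by (auto simp: self_identifying_code_def is_code_def circulant_1_4_def)
  then have "finite {card C | C. self_identifying_code ?G C}"
    by (rule finite_subset) simp
  moreover have "card (optimal_code k) \<le> card C" if "self_identifying_code ?G C" for C
    using card_self_identifying_code_ge[OF _ _ that] card_optimal_code[of k] assms by simp
  ultimately have "gamma_SID ?G = card (optimal_code k)"
    unfolding gamma_SID_def using self_identifying_optimal_code[OF assms] by (intro Min_eqI) auto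
  then show ?thesis using card_optimal_code assms by simp
qed

end
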